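(* Let $T$ be an $N$-tableau on $A$ and $x\in A$. Then $x\to T=N(x\,r(T))$.
   Context: $A$ is a finite totally ordered alphabet. Tableaux are in French convention (rows numbered from the bottom, row 1 at the bottom). An $N$-tableau is a tableau with strictly increasing rows in which each row, viewed as a subset of $A$, is contained in the row below. $r(T)$ is the row-word of $T$: the concatenation of the rows read left to right, starting with the top row and ending with the bottom row. $N$-insertion of $x$ into a strictly increasing row $B$ gives $B\cup\{x\}$ and bumps a copy of the smallest element of $B$ strictly larger than $x$, if one exists; $N$-insertion into an $N$-tableau inserts into row 1, then the bumped letter into row 2, and so on. For $w=a_1\cdots a_n$, $N(w)$ is obtained from the empty tableau by $N$-inserting $a_1,\ldots,a_n$ successively. Left insertion $x\to T$: let the rows of $T$ be $R_1,\ldots,R_k$ (bottom to top, viewed as subsets), $p_i=\min R_i$. For each $i$ let $y_i$ be the smallest element of $R_i$ strictly greater than $x$, if it exists. Let $r$ be the largest $i$ with $x\in R_i$, and $r=0$ if there is none. Case 1: if $T$ is empty or $x\leq p_1$, then $x\to T$ is obtained by replacing $R_1$ by $R_1\cup\{x\}$. Otherwise $x>p_1$; let $t'$ be the largest $i$ with $x>p_i$ and $t=t'+1$ (if $t=k+1$, $R_{k+1}$ denotes a new empty row). Case 2: if $R_t$ is nonempty and $x\geq p_t$ (then necessarily $x=p_t$), set $x\to T=T$. Case 3: otherwise, $x\to T$ is obtained from $T$ by (i) adding $x$ to the rows $R_{r+1},\ldots,R_t$, and (ii) for each $i$ with $r+2\leq i\leq t$, removing $y_i$ from $R_i$ if $y_i$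 and $y_{i-1}$ both exist and $y_i=y_{i-1}$ (the $y_i$ being computed in $T$). *)

theory Defs
  imports Main
begin

text \<open>A tableau is the list of its rows from the bottom row to the top row (French convention);
  the row \<open>R\<^sub>i\<close> is \<open>T ! (i - 1)\<close>. The rows are nonempty words, their lengths form a partition,
  they weakly increase from left to right, and the columns strictly increase from bottom to top.\<close>

definition tableau :: "'a::linorder set \<Rightarrow> 'a list list \<Rightarrow> bool" where
  "tableau A T \<longleftrightarrow>
     (\<forall>R \<in> set T. R \<noteq> [] \<and> set R \<subseteq> A \<and> sorted R) \<and>
     (\<forall>i. Suc i < length T \<longrightarrow>
        length (T ! Suc i) \<le> length (T ! i) \<and>
        (\<forall>j < length (T ! Suc i). T ! i ! j < T ! Suc i ! j))"

definition N_tableau :: "'a::linorder set \<Rightarrow> 'a list list \<Rightarrow> bool" where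
  "N_tableau A T \<longleftrightarrow>
     tableau A T \<and>
     (\<forall>R \<in> set T. sorted_wrt (<) R) \<and>
     (\<forall>i. Suc i < length T \<longrightarrow> set (T ! Suc i) \<subseteq> set (T ! i))"

definition row_word :: "'a list list \<Rightarrow> 'a list" where
  "row_word T = concat (rev T)"

definition next_larger :: "'a::linorder \<Rightarrow> 'a set \<Rightarrow> 'a option" where
  "next_larger x S = (if \<exists>y\<in>S. x < y then Some (Min {y \<in> S. x < y}) else None)"

text \<open>The strictly increasing word corresponding to a finite set is its \<^const>\<open>sorted_list_of_set\<close>.\<close>

fun N_insert :: "'a::linorder \<Rightarrow> 'a list list \<Rightarrow> 'a list list" where
  "N_insert x [] = [[x]]"
| "N_insert x (B # T) =
     sorted_list_of_set (insert x (set B)) #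
     (case next_larger x (set B) of None \<Rightarrow> T | Some y \<Rightarrow> N_insert y T)"

definition N :: "'a::linorder list \<Rightarrow> 'a list list" where
  "N w = foldl (\<lambda>T a. N_insert a T) [] w"

text \<open>Rows numbered from 1 and viewed as sets; rows outside the tableau are empty.\<close>

definition row_set :: "'a list list \<Rightarrow> nat \<Rightarrow> 'a set" where
  "row_set T i = (if 1 \<le> i \<and> i \<le> length T then set (T ! (i - 1)) else {})"

definition left_insert :: "'a::linorder \<Rightarrow> 'a list list \<Rightarrow> 'a list list" where
  "left_insert x T =
    (let k = length T;
         R = row_set T;
         p = (\<lambda>i. Min (R i));
         y = (\<lambda>i. next_larger x (R i));
         r = Max ({0} \<union> {i \<in> {1..k}. x \<in> R i})
     in if T = [] \<or> x \<le> p 1 then sorted_list_of_set (R 1 \<union> {x}) # tl T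
        else
          let t' = Max {i \<in> {1..k}. p i < x};
              t = t' + 1
          in if R t \<noteq> {} \<and> p t \<le> x then T
             else map (\<lambda>i. sorted_list_of_set
                     ((R i \<union> (if r + 1 \<le> i \<and> i \<le> t then {x} else {})) -
                      (if r + 2 \<le> i \<and> i \<le> t \<and> y i \<noteq> None \<and> y (i - 1) \<noteq> None \<and> y i = y (i - 1)
                       then {the (y i)} else {})))
                   [1..<max k t + 1])"

end

theory Submission
  imports Defs
begin

text \<open>
  Inserting a weakly increasing word letter by letter is the same as pushing it through the rows one
  at a time: the first row absorbs it, and the bumped letters form a weakly increasing word again.
  Hence inserting a row acts on tableaux whose rows are viewed as sets, and multiplicities in the
  bumped words do not matter. By induction on the number of rows it then suffices to insert
  the bottom row \<open>B\<close> into \<open>x \<rightarrow> T'\<close>, where \<open>T'\<close> consists of the other rows. If \<open>B\<close> contains all of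
  the next row and has a smaller minimum, the set of letters it bumps is this row itself; with
  \<open>x\<close> added to the next row, the only letter that can fail to be bumped is the successor of \<open>x\<close>,
  which happens exactly under the removal rule (ii).
\<close>

section \<open>Inserting a weakly increasing word\<close>

lemma next_larger_eq_Some_iff:
  assumes "finite S"
  shows "next_larger x S = Some y \<longleftrightarrow> y \<in> S \<and> x < y \<and> (\<forall>z\<in>S. x < z \<longrightarrow> y \<le> z)"
proof
  assume "next_larger x S = Some y"
  then have ex: "\<exists>y\<in>S. x < y" and y: "y = Min {y \<in> S. x < y}"
    unfolding next_larger_def by (auto split: if_splits)
  from ex assms have "y \<in> {y \<in> S. x < y}"
    unfolding y by (intro Min_in) auto
  moreover have "\<forall>z\<in>S. x < z \<longrightarrow> y \<le> z"
    using assms unfolding y by (auto intro: Min_le)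
  ultimately show "y \<in> S \<and> x < y \<and> (\<forall>z\<in>S. x < z \<longrightarrow> y \<le> z)"
    by auto
next
  assume "y \<in> S \<and> x < y \<and> (\<forall>z\<in>S. x < z \<longrightarrow> y \<le> z)"
  moreover from this have "Min {y \<in> S. x < y} = y"
    using assms by (intro Min_eqI) auto
  ultimately show "next_larger x S = Some y"
    unfolding next_larger_def by auto
qed

lemma next_larger_empty [simp]: "next_larger x {} = None"
  by (simp add: next_larger_def)

lemma next_larger_insert_le: "b \<le> a \<Longrightarrow> next_larger a (insert b S) = next_larger a S"
proof -
  assume "b \<le> a"
  then have "{y \<in> insert b S. a < y} = {y \<in> S. a < y}" and
    "(\<exists>y\<in>insert b S. a < y) \<longleftrightarrow> (\<exists>y\<in>S. a < y)"
    by auto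
  then show ?thesis
    unfolding next_larger_def by metis
qed

lemma next_larger_mono:
  assumes "finite S" "a \<le> b" "next_larger a S = Some c" "next_larger b S = Some d"
  shows "c \<le> d"
  using assms by (auto simp: next_larger_eq_Some_iff)

text \<open>All bumps are computed against the fixed row \<open>S\<close>, although the row grows
  during insertion. For weakly increasing words \<open>bumped_word_insert\<close> makes the two
  agree.\<close>

definition bumped_word :: "'a::linorder set \<Rightarrow> 'a list \<Rightarrow> 'a list" where
  "bumped_word S = List.map_filter (\<lambda>a. next_larger a S)"

definition bumped_set :: "'a::linorder set \<Rightarrow> 'a set \<Rightarrow> 'a set" where
  "bumped_set S W = {y. \<exists>a\<in>W. next_larger a S = Some y}"

lemma bumped_word_Nil [simp]: "bumped_word S [] = []"
  by (simp add: bumped_word_def map_filter_simps)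

lemma bumped_word_empty [simp]: "bumped_word {} w = []"
  by (induction w) (simp_all add: bumped_word_def map_filter_simps)

lemma bumped_word_Cons:
  "bumped_word S (a # w) =
     (case next_larger a S of None \<Rightarrow> bumped_word S w | Some y \<Rightarrow> y # bumped_word S w)"
  by (simp add: bumped_word_def map_filter_simps split: option.split)

lemma set_bumped_word: "set (bumped_word S w) = bumped_set S (set w)"
  by (induction w) (auto simp: bumped_word_Cons bumped_set_def split: option.splits)

lemma sorted_bumped_word:
  assumes "finite S" "sorted w"
  shows "sorted (bumped_word S w)"
  using assms(2)
proof (induction w)
  case (Cons a w)
  then show ?case
    by (auto simp: bumped_word_Cons set_bumped_word bumped_set_def
        intro: next_larger_mono[OF assms(1)] split: option.splits)
qed simp

text \<open>A letter bumps only strictly larger ones, so \<open>b\<close>, being at most every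
  letter of \<open>w\<close>, is never bumped and never competes for a successor.\<close>

lemma bumped_word_insert:
  assumes "\<forall>a\<in>set w. b \<le> a"
  shows "bumped_word (insert b S) w = bumped_word S w"
  using assms by (induction w) (auto simp: bumped_word_Cons next_larger_insert_le split: option.split)

lemma foldl_N_insert_Cons:
  assumes "finite S" "sorted w"
  shows "foldl (\<lambda>T a. N_insert a T) (sorted_list_of_set S # T) w =
         sorted_list_of_set (S \<union> set w) # foldl (\<lambda>T a. N_insert a T) T (bumped_word S w)"
  using assms
proof (induction w arbitrary: S T)
  case (Cons a w)
  then have "bumped_word (insert a S) w = bumped_word S w"
    by (intro bumped_word_insert) auto
  with Cons show ?case
    by (simp add: bumped_word_Cons del: sorted_list_of_set_insert_remove split: option.split)
qed simp

text \<open>On an empty tableau a nonempty weakly increasing word forms a single row, since its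
  letters do not bump one another; an empty word must not create an empty row.\<close>

fun insert_rows :: "'a::linorder set \<Rightarrow> 'a set list \<Rightarrow> 'a set list" where
  "insert_rows W [] = (if W = {} then [] else [W])"
| "insert_rows W (S # Ss) = (S \<union> W) # insert_rows (bumped_set S W) Ss"

lemma foldl_N_insert_eq_insert_rows:
  assumes "sorted w" "\<forall>S\<in>set Ss. finite S"
  shows "foldl (\<lambda>T a. N_insert a T) (map sorted_list_of_set Ss) w =
         map sorted_list_of_set (insert_rows (set w) Ss)"
  using assms
proof (induction Ss arbitrary: w)
  case Nil
  show ?case
  proof (cases w)
    case (Cons a v)
    with Nil have "bumped_word {a} v = []"
      by (simp add: bumped_word_insert)
    with Nil Cons foldl_N_insert_Cons[of "{a}" v "[]"] show ?thesis
      by simp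
  qed simp
next
  case (Cons S Ss)
  then show ?case
    by (simp add: foldl_N_insert_Cons sorted_bumped_word set_bumped_word)
qed

section \<open>Tableaux as chains of sets\<close>

text \<open>Given the inclusion, comparing the minima encodes strictly increasing columns: in
  \<open>P\<close>, the letters below the j-th letter of \<open>R\<close> include
  \<open>Min P\<close> and all preceding letters of \<open>R\<close>.\<close>

definition supports :: "'a::linorder set \<Rightarrow> 'a set \<Rightarrow> bool" where
  "supports P R \<longleftrightarrow> R \<subseteq> P \<and> Min P < Min R"

definition set_tableau :: "'a::linorder set list \<Rightarrow> bool" where
  "set_tableau Ss \<longleftrightarrow> (\<forall>S\<in>set Ss. finite S \<and> S \<noteq> {}) \<and> sorted_wrt supports Ss"

lemma transp_supports: "transp supports"
  unfolding supports_def by (auto intro!: transpI)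

lemma set_tableau_singleton [simp]: "set_tableau [S] \<longleftrightarrow> finite S \<and> S \<noteq> {}"
  by (simp add: set_tableau_def)

lemma set_tableau_Cons_Cons:
  "set_tableau (P # R # Ss) \<longleftrightarrow> finite P \<and> P \<noteq> {} \<and> supports P R \<and> set_tableau (R # Ss)"
  unfolding set_tableau_def using sorted_wrt2[OF transp_supports, of P R Ss] by auto

lemma set_tableau_ConsD: "set_tableau (P # Ss) \<Longrightarrow> set_tableau Ss"
  by (auto simp: set_tableau_def)

lemma set_tableau_supports: "set_tableau (P # Ss) \<Longrightarrow> Q \<in> set Ss \<Longrightarrow> supports P Q"
  by (simp add: set_tableau_def)

lemma set_tableau_map_set:
  assumes "N_tableau A T"
  shows "set_tableau (map set T)"
proof -
  have strict: "sorted_wrt (<) R" and ne: "R \<noteq> []" if "R \<in> set T" for R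
    using assms that by (auto simp: N_tableau_def tableau_def)
  have Min_set: "Min (set R) = R ! 0" if "R \<in> set T" for R
    using strict[OF that] ne[OF that] by (cases R) (auto intro!: Min_eqI)
  have "supports (set (T ! i)) (set (T ! Suc i))" if "Suc i < length T" for i
  proof -
    have "T ! i \<in> set T" "T ! Suc i \<in> set T"
      using that by auto
    then show ?thesis
      using that assms Min_set ne
      by (auto simp: N_tableau_def tableau_def supports_def)
  qed
  then have "sorted_wrt supports (map set T)"
    using sorted_wrt_iff_nth_Suc_transp[OF transp_supports, of "map set T"] by simp
  then show ?thesis
    using ne by (auto simp: set_tableau_def)
qed

lemma map_sorted_list_of_set_map_set:
  assumes "\<forall>R\<in>set T. sorted_wrt (<) R"
  shows "map sorted_list_of_set (map set T) = T"
  using assms by (induction T) (auto simp: strict_sorted_iff sorted_list_of_set.idem_if_sorted_distinct)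

text \<open>The predecessor of \<open>c\<close> in \<open>P\<close> is the best candidate in
  \<open>P\<close> for bumping \<open>c\<close>: it leaves the smallest gap below
  \<open>c\<close>.\<close>

lemma predecessor_exists:
  fixes c :: "'a::linorder"
  assumes "finite P" "P \<noteq> {}" "Min P < c"
  obtains b where "b \<in> P" "b < c" "\<And>z. z \<in> P \<Longrightarrow> z < c \<Longrightarrow> z \<le> b"
proof
  have "Min P \<in> {b \<in> P. b < c}"
    using assms Min_in by blast
  then have "Max {b \<in> P. b < c} \<in> {b \<in> P. b < c}"
    using assms(1) by (intro Max_in) auto
  then show "Max {b \<in> P. b < c} \<in> P" "Max {b \<in> P. b < c} < c"
    by auto
  show "z \<le> Max {b \<in> P. b < c}" if "z \<in> P" "z < c" for z
    using assms(1) that by (intro Max_ge) auto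
qed

text \<open>Each \<open>c\<close> in \<open>R\<close> is bumped by its predecessor in
  \<open>P\<close>: as \<open>R \<subseteq> P\<close>, no letter of \<open>R\<close> lies strictly
  between the two.\<close>

lemma bumped_set_self:
  assumes P: "finite P" "P \<noteq> {}" and "supports P R"
  shows "bumped_set R P = R"
proof
  have fin: "finite R"
    using assms finite_subset by (auto simp: supports_def)
  then show "bumped_set R P \<subseteq> R"
    by (auto simp: bumped_set_def next_larger_eq_Some_iff)
  show "R \<subseteq> bumped_set R P"
  proof
    fix c assume c: "c \<in> R"
    have "Min P < c"
      using assms(3) c fin by (auto simp: supports_def intro: less_le_trans)
    then obtain b where b: "b \<in> P" "b < c" "\<And>z. z \<in> P \<Longrightarrow> z < c \<Longrightarrow> z \<le> b"
      using predecessor_exists P by metis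
    then have "next_larger b R = Some c"
      using assms(3) c fin by (auto simp: next_larger_eq_Some_iff supports_def not_less[symmetric])
    with b show "c \<in> bumped_set R P"
      by (auto simp: bumped_set_def)
  qed
qed

text \<open>At each level the inserted set swallows the row it meets and bumps exactly that row,
  which is then inserted one level higher; the last one becomes a new top row.\<close>

lemma insert_rows_set_tableau:
  assumes "set_tableau (P # Ss)"
  shows "insert_rows P Ss = P # Ss"
  using assms
proof (induction Ss arbitrary: P)
  case (Cons R Ss)
  then have "bumped_set R P = R" "R \<union> P = P" "set_tableau (R # Ss)"
    using bumped_set_self[of P R] by (auto simp: set_tableau_Cons_Cons supports_def)
  with Cons.IH show ?case by simp
qed auto

section \<open>Left insertion row by row\<close>

text \<open>The modification of a row \<open>R\<close> by the left insertion of \<open>x\<close> depends only on \<open>R\<close> and the row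
  \<open>P\<close> below it: \<open>x\<close> is added iff \<open>Min P < x\<close>, and \<open>r + 2 \<le> i\<close> says that \<open>x \<notin> P\<close>. The row above the
  top row counts as empty.\<close>

definition modified_row :: "'a::linorder \<Rightarrow> 'a set \<Rightarrow> 'a set \<Rightarrow> 'a set" where
  "modified_row x P R =
     insert x R - {y. x \<notin> P \<and> next_larger x R = Some y \<and> next_larger x P = Some y}"

fun modified_rows :: "'a::linorder \<Rightarrow> 'a set \<Rightarrow> 'a set list \<Rightarrow> 'a set list" where
  "modified_rows x P [] = (if Min P < x then [{x}] else [])"
| "modified_rows x P (R # Ss) =
     (if Min P < x then modified_row x P R # modified_rows x R Ss else R # Ss)"

text \<open>A uniform version of all cases. The bottom row may always receive \<open>x\<close>: in
  the case \<open>x = p_t\<close> it contains \<open>x\<close> already, since it contains the row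
  \<open>R_t\<close>.\<close>

fun left_insert_sets :: "'a::linorder \<Rightarrow> 'a set list \<Rightarrow> 'a set list" where
  "left_insert_sets x [] = [{x}]"
| "left_insert_sets x (R # Ss) = insert x R # modified_rows x R Ss"

lemma modified_rows_le: "x \<le> Min P \<Longrightarrow> modified_rows x P Ss = Ss"
  by (cases Ss) auto

lemma mem_modified_row: "finite R \<Longrightarrow> x \<in> modified_row x P R"
  by (auto simp: modified_row_def next_larger_eq_Some_iff)

text \<open>A letter \<open>c\<close> above \<open>Min P\<close> is bumped iff no letter of
  \<open>insert x R\<close> lies strictly between \<open>c\<close> and its predecessor in
  \<open>P\<close>. As \<open>R \<subseteq> P\<close>, only \<open>x\<close> can lie there, and then
  \<open>c\<close> is the successor of \<open>x\<close> in both rows. The assumptions are phrased so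
  that \<open>R = {}\<close> is allowed.\<close>

lemma bumped_set_insert:
  assumes P: "finite P" "P \<noteq> {}" and sub: "R \<subseteq> P" and less: "\<forall>c\<in>R. Min P < c"
  shows "bumped_set (insert x R) P = (if Min P < x then modified_row x P R else R)"
proof -
  have fin: "finite R"
    using P(1) sub finite_subset by auto
  have iff: "c \<in> bumped_set (insert x R) P \<longleftrightarrow>
      c \<in> insert x R \<and> Min P < c \<and> (\<exists>b\<in>P. b < c \<and> (\<forall>z\<in>insert x R. z < c \<longrightarrow> z \<le> b))" for c
  proof -
    have *: "Min P < c" if "b \<in> P" "b < c" for b
      using P(1) that by (meson Min_le le_less_trans)
    have "next_larger b (insert x R) = Some c \<longleftrightarrow>
        c \<in> insert x R \<and> b < c \<and> (\<forall>z\<in>insert x R. z < c \<longrightarrow> z \<le> b)" for b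
      using fin next_larger_eq_Some_iff[of "insert x R" b c] by (meson finite_insert leD leI)
    then show ?thesis
      unfolding bumped_set_def using * by blast
  qed
  have "c \<in> bumped_set (insert x R) P \<longleftrightarrow>
      c \<in> insert x R \<and> Min P < c \<and> \<not> (x \<notin> P \<and> next_larger x R = Some c \<and> next_larger x P = Some c)"
    for c
  proof (cases "c \<in> insert x R \<and> Min P < c")
    case c: True
    then obtain b where b: "b \<in> P" "b < c" and b_max: "\<And>z. z \<in> P \<Longrightarrow> z < c \<Longrightarrow> z \<le> b"
      using predecessor_exists P by metis
    \<comment> \<open>The predecessor \<open>b\<close> is the largest possible witness, and the
      letters of \<open>R\<close> satisfy the bound by maximality of \<open>b\<close>; the condition
      on \<open>x\<close> remains.\<close>
    have "(\<exists>b\<in>P. b < c \<and> (\<forall>z\<in>insert x R. z < c \<longrightarrow> z \<le> b)) \<longleftrightarrow> (x < c \<longrightarrow> x \<le> b)"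
    proof
      assume "x < c \<longrightarrow> x \<le> b"
      then have "\<forall>z\<in>insert x R. z < c \<longrightarrow> z \<le> b"
        using b_max sub by auto
      with b show "\<exists>b\<in>P. b < c \<and> (\<forall>z\<in>insert x R. z < c \<longrightarrow> z \<le> b)"
        by auto
    next
      assume "\<exists>b\<in>P. b < c \<and> (\<forall>z\<in>insert x R. z < c \<longrightarrow> z \<le> b)"
      then show "x < c \<longrightarrow> x \<le> b"
        using b_max by (meson insertI1 order_trans)
    qed
    also have "\<dots> \<longleftrightarrow> \<not> (x \<notin> P \<and> next_larger x R = Some c \<and> next_larger x P = Some c)"
    proof
      assume *: "x < c \<longrightarrow> x \<le> b"
      show "\<not> (x \<notin> P \<and> next_larger x R = Some c \<and> next_larger x P = Some c)"
      proof
        assume "x \<notin> P \<and> next_larger x R = Some c \<and> next_larger x P = Some c"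
        then have "x < c" "x \<noteq> b" "x < b \<longrightarrow> c \<le> b"
          using b P by (auto simp: next_larger_eq_Some_iff)
        with * b show False
          by auto
      qed
    next
      assume *: "\<not> (x \<notin> P \<and> next_larger x R = Some c \<and> next_larger x P = Some c)"
      show "x < c \<longrightarrow> x \<le> b"
      proof (intro impI, rule ccontr)
        assume "x < c" "\<not> x \<le> b"
        then have "c \<in> R" "x \<notin> P"
          using c b_max by auto
        moreover have "c \<le> z" if "z \<in> P" "x < z" for z
          using b_max[OF that(1)] that \<open>\<not> x \<le> b\<close> by force
        ultimately show False
          using * \<open>x < c\<close> P fin sub by (auto simp: next_larger_eq_Some_iff)
      qed
    qed
    finally show ?thesis
      using c iff by blast
  qed (use iff in blast)
  then have *: "bumped_set (insert x R) P = {c \<in> modified_row x P R. Min P < c}"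
    by (auto simp: modified_row_def)
  show ?thesis
  proof (cases "Min P < x")
    case True
    with less show ?thesis
      unfolding * by (auto simp: modified_row_def)
  next
    case False
    \<comment> \<open>If \<open>x \<notin> P\<close>, then \<open>x < Min P\<close>, so the
      successor of \<open>x\<close> in \<open>P\<close> is \<open>Min P\<close>, which lies below
      every letter of \<open>R\<close>: nothing is removed.\<close>
    have "next_larger x P \<noteq> Some c" if "x \<notin> P" "c \<in> R" for c
    proof -
      have "Min P \<in> P" "Min P < c"
        using Min_in[OF P] that less by auto
      moreover from this have "x < Min P"
        using False that by (metis not_less_iff_gr_or_eq)
      ultimately show ?thesis
        using P(1) by (metis next_larger_eq_Some_iff not_le)
    qed
    with False less show ?thesis
      unfolding * by (auto simp: modified_row_def)
  qed
qed

text \<open>Once the rows above the bottom one are known to form a tableau,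
  \<open>insert_rows_set_tableau\<close> applies to them. The point is that removals preserve the
  inclusions between rows.\<close>

lemma set_tableau_modified_rows:
  assumes "set_tableau (P # Ss)" "Min P < x"
  shows "set_tableau (modified_rows x P Ss)"
  using assms
proof (induction Ss arbitrary: P)
  case (Cons R Ss)
  from Cons.prems have tab: "set_tableau (R # Ss)" and R: "finite R" "R \<noteq> {}" and
    PR: "finite P" "P \<noteq> {}" "supports P R"
    by (auto simp: set_tableau_Cons_Cons set_tableau_def)
  let ?S = "modified_row x P R"
  have S: "finite ?S" "x \<in> ?S" "?S \<noteq> {}"
    using R mem_modified_row[of R x P] by (auto simp: modified_row_def)
  have "set_tableau (?S # modified_rows x R Ss)"
  proof (cases "Min R < x")
    case True
    then have IH: "set_tableau (modified_rows x R Ss)"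
      using Cons.IH tab by blast
    \<comment> \<open>A removed letter exceeds \<open>x\<close>, so \<open>Min R\<close> survives
      and the minimum of the new row is at most \<open>Min R\<close>.\<close>
    have "next_larger x R \<noteq> Some (Min R)"
      using R(1) True by (metis next_larger_eq_Some_iff order_less_asym)
    then have "Min R \<in> ?S"
      using Min_in[OF R] by (simp add: modified_row_def)
    then have Min_S: "Min ?S \<le> Min R"
      using S by auto
    have sup: "supports ?S Q"
      if "Q \<subseteq> ?S" "finite Q" "Q \<noteq> {}" "\<forall>c\<in>Q. Min R < c" for Q
    proof -
      have "Min R < Min Q"
        using that Min_in[of Q] by blast
      with that(1) Min_S show ?thesis
        by (auto simp: supports_def)
    qed
    show ?thesis
    proof (cases Ss)
      case Nil
      then show ?thesis
        using S True sup[of "{x}"] by (simp add: set_tableau_Cons_Cons)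
    next
      case (Cons Q Qs)
      then have Q: "finite Q" "Q \<noteq> {}" "supports R Q"
        using tab by (auto simp: set_tableau_Cons_Cons set_tableau_def)
      have "modified_row x R Q \<subseteq> ?S"
      proof
        fix c assume c: "c \<in> modified_row x R Q"
        \<comment> \<open>If \<open>c\<close> is removed from \<open>R\<close> while lying in
          \<open>Q\<close>, it is also the successor of \<open>x\<close> in \<open>Q\<close>; since
          \<open>x \<notin> P\<close> forces \<open>x \<notin> R\<close>, it is removed from
          \<open>Q\<close> too.\<close>
        have "next_larger x Q = Some c" if "next_larger x R = Some c" "c \<in> Q"
        proof -
          have "x < c" "\<forall>z\<in>R. x < z \<longrightarrow> c \<le> z"
            using that(1) R(1) by (simp_all add: next_larger_eq_Some_iff)
          moreover have "Q \<subseteq> R"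
            using Q(3) by (simp add: supports_def)
          ultimately show ?thesis
            using that(2) Q(1) by (auto simp: next_larger_eq_Some_iff)
        qed
        with c show "c \<in> ?S"
          using Q(3) PR(3) S(2) by (auto simp: modified_row_def supports_def)
      qed
      moreover have "\<forall>c\<in>modified_row x R Q. Min R < c"
        using Q True by (auto simp: modified_row_def supports_def intro: less_le_trans)
      ultimately have "supports ?S (modified_row x R Q)"
        using mem_modified_row[of Q x R] Q by (intro sup) (auto simp: modified_row_def)
      then show ?thesis
        using IH Cons True S by (simp add: set_tableau_Cons_Cons)
    qed
  next
    case False
    show ?thesis
    proof (cases Ss)
      case Nil
      then show ?thesis using False S by simp
    next
      case (Cons Q Qs)
      then have Q: "finite Q" "Q \<noteq> {}" "supports R Q"
        using tab by (auto simp: set_tableau_Cons_Cons set_tableau_def)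
      \<comment> \<open>Here \<open>x \<le> Min R\<close>, so for \<open>x \<notin> R\<close> the
        successor of \<open>x\<close> in \<open>R\<close> is \<open>Min R\<close>, which is not in
        \<open>Q\<close>. Hence no letter of the unchanged row \<open>Q\<close> is removed below
        it.\<close>
      have "next_larger x R \<noteq> Some c" if "c \<in> Q" "x \<notin> R" for c
      proof -
        have "Min R < c" "Min R \<in> R"
          using that(1) Q Min_in[OF R] by (auto simp: supports_def intro: less_le_trans)
        moreover from this have "x < Min R"
          using False that by (metis not_less_iff_gr_or_eq)
        ultimately show ?thesis
          using R(1) by (metis next_larger_eq_Some_iff not_le)
      qed
      then have "Q \<subseteq> ?S"
        using Q PR by (auto simp: modified_row_def supports_def)
      moreover have "Min ?S < Min Q"
      proof -
        have "Min ?S \<le> x" "x \<le> Min R" "Min R < Min Q"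
          using S False Q(3) by (auto simp: supports_def)
        then show ?thesis
          by simp
      qed
      ultimately show ?thesis
        using S False Cons tab by (auto simp: set_tableau_Cons_Cons supports_def)
    qed
  qed
  with Cons.prems show ?case by simp
qed auto

text \<open>The first row absorbs \<open>P\<close>; what it bumps already forms a tableau with the
  rows above, so the remaining insertions merely reproduce that tableau.\<close>

lemma insert_rows_left_insert_sets:
  assumes "set_tableau (P # Ss)"
  shows "insert_rows P (left_insert_sets x Ss) = left_insert_sets x (P # Ss)"
proof (cases Ss)
  case Nil
  \<comment> \<open>The missing row above \<open>P\<close> is handled as
    \<open>R = {}\<close>.\<close>
  have "bumped_set {x} P = (if Min P < x then {x} else {})"
    using bumped_set_insert[of P "{}" x] assms Nil by (simp add: modified_row_def)
  with Nil show ?thesis by simp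
next
  case (Cons R Rs)
  with assms have P: "finite P" "P \<noteq> {}" "supports P R" and
    R: "finite R" "R \<noteq> {}" "set_tableau (R # Rs)"
    by (auto simp: set_tableau_Cons_Cons set_tableau_def)
  have bump: "bumped_set (insert x R) P = (if Min P < x then modified_row x P R else R)"
    using P R by (intro bumped_set_insert) (auto simp: supports_def intro: less_le_trans)
  have un: "insert x R \<union> P = insert x P"
    using P by (auto simp: supports_def)
  show ?thesis
  proof (cases "Min P < x")
    case True
    then have "set_tableau (modified_row x P R # modified_rows x R Rs)"
      using set_tableau_modified_rows[OF assms True] Cons by simp
    then show ?thesis
      using Cons bump un True by (simp add: insert_rows_set_tableau)
  next
    case False
    then have "x \<le> Min R"
      using P by (auto simp: supports_def)
    then show ?thesis
      using Cons bump un False R by (simp add: insert_rows_set_tableau modified_rows_le)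
  qed
qed

lemma finite_left_insert_sets:
  assumes "\<forall>S\<in>set Ss. finite S"
  shows "\<forall>S\<in>set (left_insert_sets x Ss). finite S"
proof -
  have "\<forall>S\<in>set (modified_rows x P Ss). finite S" if "\<forall>S\<in>set Ss. finite S" for P Ss
    using that by (induction Ss arbitrary: P) (auto simp: modified_row_def)
  with assms show ?thesis by (cases Ss) auto
qed

lemma N_Cons_row_word:
  assumes "set_tableau (map set T)" "\<forall>R\<in>set T. sorted R"
  shows "N (x # row_word T) = map sorted_list_of_set (left_insert_sets x (map set T))"
  using assms
proof (induction T)
  case Nil
  then show ?case by (simp add: N_def row_word_def)
next
  case (Cons B T)
  \<comment> \<open>The bottom row \<open>B\<close> ends the row word, so its letters are inserted
    last.\<close>
  have "N (x # row_word (B # T)) = foldl (\<lambda>T a. N_insert a T) (N (x # row_word T)) B"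
    by (simp add: N_def row_word_def)
  also have "N (x # row_word T) = map sorted_list_of_set (left_insert_sets x (map set T))"
    using Cons set_tableau_ConsD by auto
  also have "foldl (\<lambda>T a. N_insert a T) \<dots> B =
      map sorted_list_of_set (insert_rows (set B) (left_insert_sets x (map set T)))"
    using Cons.prems by (intro foldl_N_insert_eq_insert_rows finite_left_insert_sets) auto
  also have "insert_rows (set B) (left_insert_sets x (map set T)) =
      left_insert_sets x (map set (B # T))"
    using Cons.prems insert_rows_left_insert_sets[of "set B" "map set T" x] by simp
  finally show ?case .
qed

section \<open>Comparison with the definition by cases\<close>

text \<open>This is Case 2. The rows below \<open>Q\<close> contain \<open>x\<close> by inclusion,
  so nothing is added or removed there; the recursion stops at \<open>Q\<close>, whose minimum is
  not below \<open>x\<close>.\<close>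

lemma modified_rows_Min_eq:
  assumes "set_tableau (P # Ss)" "Q \<in> set (P # Ss)" "x = Min Q"
  shows "modified_rows x P Ss = Ss"
  using assms
proof (induction Ss arbitrary: P)
  case (Cons R Ss)
  show ?case
  proof (cases "Min P < x")
    case True
    then have Q: "Q \<in> set (R # Ss)"
      using Cons.prems by auto
    have "finite Q \<and> Q \<noteq> {}"
      using Cons.prems(1,2) by (auto simp: set_tableau_def)
    then have "x \<in> Q"
      using Cons.prems(3) Min_in by blast
    moreover have "Q = R \<or> supports R Q" "R \<subseteq> P"
      using set_tableau_supports[of R Ss Q] set_tableau_supports[OF Cons.prems(1), of R]
        set_tableau_ConsD[OF Cons.prems(1)] Q
      by (auto simp: supports_def)
    ultimately have "x \<in> R" "x \<in> P"
      by (auto simp: supports_def)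
    moreover have "modified_rows x R Ss = Ss"
      using Cons Q set_tableau_ConsD by blast
    ultimately show ?thesis
      by (auto simp: modified_row_def)
  qed simp
qed auto

lemma length_modified_rows:
  assumes "set_tableau (P # Ss)"
  shows "length (modified_rows x P Ss) = length Ss + (if Min (last (P # Ss)) < x then 1 else 0)"
  using assms
proof (induction Ss arbitrary: P)
  case (Cons R Ss)
  have "Min P < Min (last (R # Ss))"
    using set_tableau_supports[OF Cons.prems, of "last (R # Ss)"] by (simp add: supports_def)
  with Cons.IH[OF set_tableau_ConsD[OF Cons.prems]] show ?case by auto
qed auto

text \<open>The recursion stops at the first row whose minimum is at least \<open>x\<close>. Since
  minima strictly increase upwards, testing the row just below, \<open>(P # Ss) ! i\<close>, detects
  the same rows.\<close>

lemma nth_modified_rows: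
  assumes "set_tableau (P # Ss)" "i < length (modified_rows x P Ss)"
  shows "modified_rows x P Ss ! i =
    (let R = (if i < length Ss then Ss ! i else {})
     in if Min ((P # Ss) ! i) < x then modified_row x ((P # Ss) ! i) R else R)"
  using assms
proof (induction Ss arbitrary: P i)
  case Nil
  then show ?case
    by (auto simp: modified_row_def split: if_splits)
next
  case (Cons R Ss)
  show ?case
  proof (cases "Min P < x")
    case True
    with Cons.prems Cons.IH[OF set_tableau_ConsD[OF Cons.prems(1)], of "i - 1"] show ?thesis
      by (cases i) simp_all
  next
    case False
    then have "i < length (R # Ss)"
      using Cons.prems by simp
    moreover have "\<not> Min ((P # R # Ss) ! i) < x"
    proof (cases i)
      case (Suc j)
      then have "supports P ((R # Ss) ! j)"
        using set_tableau_supports[OF Cons.prems(1)] \<open>i < length (R # Ss)\<close>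
        by (meson Suc_lessD nth_mem)
      with False Suc show ?thesis
        by (auto simp: supports_def)
    qed (use False in simp)
    ultimately show ?thesis
      using False by (auto simp: Let_def)
  qed
qed

lemma left_insert_eq_left_insert_sets:
  assumes tab: "set_tableau (map set T)" and sorted: "\<forall>R\<in>set T. sorted_wrt (<) R"
  shows "left_insert x T = map sorted_list_of_set (left_insert_sets x (map set T))"
proof -
  define R where "R = row_set T"
  define k where "k = length T"
  define r where "r = Max ({0} \<union> {i \<in> {1..k}. x \<in> R i})"
  define t' where "t' = Max {i \<in> {1..k}. Min (R i) < x}"
  define t where "t = t' + 1"
  define y where "y = (\<lambda>i. next_larger x (R i))"
  note idem = map_sorted_list_of_set_map_set[OF sorted]
  show ?thesis
  proof (cases T)
    case Nil
    then show ?thesis by (simp add: left_insert_def row_set_def)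
  next
    case (Cons B Ts)
    have R1: "R 1 = set B"
      by (simp add: R_def row_set_def Cons)
    have k1: "1 \<le> k"
      by (simp add: k_def Cons)
    have R_nth: "R (Suc i) = map set T ! i" if "i < k" for i
      using that by (simp add: R_def row_set_def k_def)
    have R_empty: "R i = {}" if "i > k" for i
      using that by (simp add: R_def row_set_def k_def)
    have R_fin: "finite (R i)" for i
      by (simp add: R_def row_set_def)
    have R_sup: "supports (R i) (R j)" if "1 \<le> i" "i < j" "j \<le> k" for i j
      using that tab R_nth[of "i - 1"] R_nth[of "j - 1"]
      by (auto simp: set_tableau_def sorted_wrt_iff_nth_less k_def)
    show ?thesis
    proof (cases "x \<le> Min (R 1)")
      case True
      then have "left_insert x T = sorted_list_of_set (R 1 \<union> {x}) # Ts"
        by (simp add: left_insert_def R_def Let_def Cons)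
      with True Cons idem R1 show ?thesis
        by (simp add: modified_rows_le)
    next
      case False
      have t'_in: "t' \<in> {i \<in> {1..k}. Min (R i) < x}"
        unfolding t'_def using False k1 by (intro Max_in) auto
      \<comment> \<open>Increasing minima turn the maximality of \<open>t'\<close> into a
        description of all rows with minimum below \<open>x\<close>.\<close>
      have less_iff: "Min (R i) < x \<longleftrightarrow> i < t" if "1 \<le> i" "i \<le> k" for i
      proof
        assume "Min (R i) < x"
        then have "i \<le> t'"
          unfolding t'_def using that by (intro Max_ge) auto
        then show "i < t"
          by (simp add: t_def)
      next
        assume "i < t"
        then have "i = t' \<or> supports (R i) (R t')"
          using that t'_in R_sup[of i t'] by (cases "i = t'") (auto simp: t_def)
        then show "Min (R i) < x"
          using t'_in by (auto simp: supports_def)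
      qed
      have t: "1 < t" "t \<le> Suc k"
        using t'_in by (auto simp: t_def)
      have def: "left_insert x T = (if R t \<noteq> {} \<and> Min (R t) \<le> x then T
             else map (\<lambda>i. sorted_list_of_set
                     ((R i \<union> (if r + 1 \<le> i \<and> i \<le> t then {x} else {})) -
                      (if r + 2 \<le> i \<and> i \<le> t \<and> y i \<noteq> None \<and> y (i - 1) \<noteq> None \<and> y i = y (i - 1)
                       then {the (y i)} else {})))
                   [1..<max k t + 1])"
      proof -
        have "(T = [] \<or> x \<le> Min (row_set T 1)) = False"
          using False Cons by (simp add: R_def)
        then show ?thesis
          by (simp only: left_insert_def R_def k_def r_def t_def t'_def y_def Let_def if_False)
      qed
      show ?thesis
      proof (cases "R t \<noteq> {} \<and> Min (R t) \<le> x")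
        case True
        then have "t \<le> k"
          using R_empty[of t] by (meson not_less)
        then have "\<not> Min (R t) < x"
          using less_iff[of t] t by auto
        with True have x: "x = Min (R t)" by auto
        have mem: "R t \<in> set (set B # map set Ts)"
        proof -
          have "map set T ! (t - 1) \<in> set (map set T)"
            using t \<open>t \<le> k\<close> by (intro nth_mem) (simp add: k_def)
          then show ?thesis
            using R_nth[of "t - 1"] t \<open>t \<le> k\<close> Cons by simp
        qed
        have "R t \<subseteq> R 1"
          using R_sup[of 1 t] t \<open>t \<le> k\<close> by (auto simp: supports_def)
        then have "insert x (set B) = set B"
          using True x R1 Min_in[OF R_fin] by (metis insert_absorb subsetD)
        moreover have "modified_rows x (set B) (map set Ts) = map set Ts"
          using tab mem x Cons by (intro modified_rows_Min_eq[of _ _ "R t"]) auto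
        ultimately have "left_insert_sets x (map set T) = map set T"
          by (simp add: Cons)
        then show ?thesis
          using True def idem by simp
      next
        case case3: False
        \<comment> \<open>Rows are nested, so those containing \<open>x\<close> are exactly the
          first \<open>r\<close>. Hence \<open>r + 2 \<le> i\<close> means that row
          \<open>i - 1\<close> lacks \<open>x\<close>, the condition \<open>x \<notin> P\<close> of
          \<open>modified_row\<close>.\<close>
        have mem_iff: "x \<in> R i \<longleftrightarrow> i \<le> r" if "1 \<le> i" for i
        proof
          assume "x \<in> R i"
          then have "i \<le> k"
            using R_empty[of i] not_less by force
          then show "i \<le> r"
            unfolding r_def using that \<open>x \<in> R i\<close> by (intro Max_ge) auto
        next
          assume "i \<le> r"
          moreover have "r \<in> {0} \<union> {i \<in> {1..k}. x \<in> R i}"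
            unfolding r_def by (intro Max_in) auto
          ultimately have "x \<in> R r" "r \<le> k"
            using that by auto
          then show "x \<in> R i"
            using R_sup[of i r] that \<open>i \<le> r\<close> by (cases "i = r") (auto simp: supports_def)
        qed
        have len: "length (left_insert_sets x (map set T)) = max k t"
        proof -
          have "last (set B # map set Ts) = R k"
            using R_nth[of "k - 1"] k1 Cons by (simp add: last_conv_nth k_def)
          moreover have "Min (R k) < x \<longleftrightarrow> t = Suc k"
            using less_iff[of k] k1 t by auto
          ultimately show ?thesis
            using length_modified_rows[of "set B" "map set Ts" x] tab Cons t k1
            by (auto simp: k_def max_def)
        qed
        \<comment> \<open>List position \<open>i\<close> holds row \<open>Suc i\<close>, so the row
          below it is \<open>R i\<close>.\<close>
        have row: "left_insert_sets x (map set T) ! i =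
            (R (Suc i) \<union> (if r + 1 \<le> Suc i \<and> Suc i \<le> t then {x} else {})) -
            (if r + 2 \<le> Suc i \<and> Suc i \<le> t \<and> y (Suc i) \<noteq> None \<and> y i \<noteq> None \<and> y (Suc i) = y i
             then {the (y (Suc i))} else {})" if i: "i < max k t" for i
        proof (cases i)
          case 0
          \<comment> \<open>For \<open>r \<ge> 1\<close> the case definition adds nothing to row 1,
            but \<open>x\<close> is already there; removal would require
            \<open>r + 2 \<le> 1\<close>.\<close>
          have "insert x (R 1) = R 1" if "1 \<le> r"
            using mem_iff[of 1] that by auto
          then show ?thesis
            using 0 Cons R1 t by (auto simp: Suc_le_eq)
        next
          case (Suc j)
          have jk: "j < k"
            using i t Suc by auto
          have "j < length (modified_rows x (set B) (map set Ts))"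
            using i len Suc Cons by simp
          moreover have "(set B # map set Ts) ! j = R i"
            using R_nth[of j] Suc jk Cons by simp
          moreover have "(if j < length (map set Ts) then map set Ts ! j else {}) = R (Suc i)"
            using R_nth[of i] R_empty[of "Suc i"] Suc Cons by (auto simp: k_def)
          ultimately have "left_insert_sets x (map set T) ! i =
              (if Min (R i) < x then modified_row x (R i) (R (Suc i)) else R (Suc i))"
            using nth_modified_rows[of "set B" "map set Ts" j x] tab Cons Suc by simp
          also have "Min (R i) < x \<longleftrightarrow> Suc i \<le> t"
            using less_iff[of i] jk Suc by auto
          finally show ?thesis
            using mem_iff[of i] mem_iff[of "Suc i"] Suc
            by (auto simp: modified_row_def y_def)
        qed
        show ?thesis
          unfolding def if_not_P[OF case3]
          by (rule nth_equalityI) (use len row in \<open>auto simp del: upt_Suc\<close>)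
      qed
    qed
  qed
qed

theorem theorem11p4:
  fixes A :: "'a::linorder set" and T :: "'a list list" and x :: 'a
  assumes "finite A" and "N_tableau A T" and "x \<in> A"
  shows "left_insert x T = N (x # row_word T)"
proof -
  have "\<forall>R\<in>set T. sorted_wrt (<) R" "\<forall>R\<in>set T. sorted R"
    using assms(2) by (auto simp: N_tableau_def tableau_def)
  with set_tableau_map_set[OF assms(2)] show ?thesis
    by (simp only: left_insert_eq_left_insert_sets N_Cons_row_word)
qed

end
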